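(* The equation $(4^{n}-1)(49^{n}-1)=x^{2}$ in positive integers $n,x$ has only the solution $n=1$, $x=12$. *)

theory Defs
  imports Main
begin

end

theory Submission
  imports Defs
begin

text \<open>
  Put \<open>a = 2 ^ n\<close> and \<open>b = 7 ^ n\<close>, so that the equation reads \<open>(a\<^sup>2 - 1) * (b\<^sup>2 - 1) = x\<^sup>2\<close>.
  Then \<open>a\<^sup>2 - 1\<close> and \<open>b\<^sup>2 - 1\<close> have the same squarefree part \<open>D\<close>, that is, \<open>a\<close> and \<open>b\<close> are
  both first coordinates of solutions of the Pell equation \<open>X\<^sup>2 - D * Y\<^sup>2 = 1\<close>, and are therefore
  values \<open>T\<^sub>i(c)\<close>, \<open>T\<^sub>j(c)\<close> of Chebyshev polynomials at one integer \<open>c\<close>, for instance the first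
  coordinate of the fundamental solution.  Lemma \<open>common_chebyshev_argument\<close> proves this by a subtractive
  Euclidean algorithm on the indices, which mentions neither \<open>D\<close> nor a fundamental solution.

  The rest is divisibility.  Chebyshev values of even index are odd, and those of odd index are odd
  multiples of \<open>c\<close>.  Hence \<open>2 ^ n = T\<^sub>i(c)\<close> forces \<open>i\<close> odd and \<open>c = 2 ^ n\<close>, and then the odd number
  \<open>7 ^ n = T\<^sub>j(c)\<close> must have even index \<open>j = 2 * m\<close>, so that \<open>7 ^ n + 1 = 2 * (T\<^sub>m(c))\<^sup>2\<close>.
  If \<open>m\<close> is even, \<open>7\<close> would divide a value \<open>T\<^sub>4\<^sub>r(c)\<close>, which quadratic residues modulo \<open>7\<close>
  exclude.  If \<open>m\<close> is odd, then \<open>2 * 4 ^ n\<close> divides \<open>7 ^ n + 1\<close>, which is never divisible by \<open>16\<close>;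
  so \<open>n = 1\<close>.
\<close>

section \<open>Chebyshev polynomials and the Pell group law\<close>

text \<open>
  The pair \<open>(cheb_T c k, cheb_U c k)\<close> consists of the coordinates of the power
  \<open>(c + sqrt (c\<^sup>2 - 1)) ^ k\<close>.  The first one is the Chebyshev polynomial of the first kind
  at \<open>c\<close>; the second one is, with index shifted by one, the Chebyshev polynomial of the second kind.
\<close>

fun cheb_T :: "int \<Rightarrow> nat \<Rightarrow> int" and cheb_U :: "int \<Rightarrow> nat \<Rightarrow> int" where
  "cheb_T c 0 = 1"
| "cheb_U c 0 = 0"
| "cheb_T c (Suc k) = c * cheb_T c k + (c\<^sup>2 - 1) * cheb_U c k"
| "cheb_U c (Suc k) = cheb_T c k + c * cheb_U c k"

lemma cheb_pell: "(cheb_T c k)\<^sup>2 - (c\<^sup>2 - 1) * (cheb_U c k)\<^sup>2 = 1"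
proof (induction k)
  case (Suc k)
  have "(cheb_T c (Suc k))\<^sup>2 - (c\<^sup>2 - 1) * (cheb_U c (Suc k))\<^sup>2
      = (cheb_T c k)\<^sup>2 - (c\<^sup>2 - 1) * (cheb_U c k)\<^sup>2"
    by (simp add: power2_eq_square algebra_simps)
  with Suc show ?case by simp
qed simp

lemma cheb_nonneg:
  assumes "c \<ge> 1"
  shows "cheb_T c k \<ge> 0" "cheb_U c k \<ge> 0"
proof -
  have "c\<^sup>2 - 1 \<ge> 0" using assms by simp
  then have "cheb_T c k \<ge> 0 \<and> cheb_U c k \<ge> 0"
    using assms by (induction k) auto
  then show "cheb_T c k \<ge> 0" "cheb_U c k \<ge> 0" by auto
qed

lemma cheb_add:
  "cheb_T c (i + k) = cheb_T c i * cheb_T c k + (c\<^sup>2 - 1) * (cheb_U c i * cheb_U c k)"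
  "cheb_U c (i + k) = cheb_U c i * cheb_T c k + cheb_T c i * cheb_U c k"
proof (induction k)
  case (Suc k)
  {
    case 1
    show ?case by (simp add: Suc algebra_simps)
  next
    case 2
    show ?case by (simp add: Suc algebra_simps)
  }
qed simp_all

lemma cheb_T_double: "cheb_T c (2 * k) = 2 * (cheb_T c k)\<^sup>2 - 1"
  using cheb_add(1)[of c k k, folded mult_2 power2_eq_square] cheb_pell[of c k] by linarith

lemma cheb_T_rec: "cheb_T c (Suc (Suc k)) = 2 * c * cheb_T c (Suc k) - cheb_T c k"
  by (simp add: power2_eq_square algebra_simps)

lemma odd_cheb_T_even: "odd (cheb_T c (2 * k))"
  by (simp add: cheb_T_double)

lemma cheb_T_odd_factor: "\<exists>q. odd q \<and> cheb_T c (2 * k + 1) = c * q"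
proof (induction k)
  case 0
  show ?case by (intro exI[of _ 1]) simp
next
  case (Suc k)
  then obtain q where q: "odd q" "cheb_T c (2 * k + 1) = c * q" by blast
  have "cheb_T c (2 * Suc k + 1) = 2 * c * cheb_T c (2 * k + 2) - cheb_T c (2 * k + 1)"
    using cheb_T_rec[of c "2 * k + 1"] by simp
  also have "\<dots> = c * (2 * cheb_T c (2 * k + 2) - q)"
    unfolding q(2) by (simp only: algebra_simps)
  finally show ?case using q(1) by (intro exI[of _ "2 * cheb_T c (2 * k + 2) - q"]) simp
qed

section \<open>Descent to a common argument\<close>

text \<open>
  If \<open>a = T\<^sub>i(c)\<close> and \<open>b = T\<^sub>j(c)\<close> with \<open>i \<le> j\<close> and \<open>s \<ge> 0\<close>, then
  \<open>a * b - s = T\<^sub>j\<^sub>-\<^sub>i(c)\<close>.  So replacing the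
  larger entry \<open>b\<close> by \<open>a * b - s\<close> is one step of the Euclidean algorithm on the (still unknown)
  indices.  The step can be carried out without knowing \<open>c\<close>, it keeps the product
  \<open>(a\<^sup>2 - 1) * (b\<^sup>2 - 1)\<close> a square, and it ends when the smaller entry is \<open>1 = T\<^sub>0(c)\<close>.
\<close>

lemma common_chebyshev_argument:
  fixes a b s :: int
  assumes "a \<ge> 1" "b \<ge> 1" "(a\<^sup>2 - 1) * (b\<^sup>2 - 1) = s\<^sup>2"
  shows "\<exists>c i j. c \<ge> 1 \<and> a = cheb_T c i \<and> b = cheb_T c j"
  using assms
proof (induction "nat (a + b)" arbitrary: a b s rule: less_induct)
  case less
  have descent: "\<exists>c i j. c \<ge> 1 \<and> u = cheb_T c i \<and> v = cheb_T c j"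
    if uv: "u \<ge> 1" "u \<le> v" "u + v = a + b" and sq: "(u\<^sup>2 - 1) * (v\<^sup>2 - 1) = s\<^sup>2" for u v :: int
  proof (cases "u = 1")
    case True
    then have "u = cheb_T v 0" "v = cheb_T v 1" by simp_all
    then show ?thesis using uv by (metis order_trans)
  next
    case False
    with uv have u: "u \<ge> 2" and v: "v \<ge> 2" by auto
    define t where "t = \<bar>s\<bar>"
    have t: "t \<ge> 0" "t\<^sup>2 = (u\<^sup>2 - 1) * (v\<^sup>2 - 1)" by (simp_all add: t_def sq)
    define w where "w = u * v - t"
    \<comment> \<open>With \<open>u = T\<^sub>i(c)\<close> and \<open>w = T\<^sub>k(c)\<close>, \<open>r\<close> will be the second term \<open>(c\<^sup>2 - 1) * U\<^sub>i(c) * U\<^sub>k(c)\<close>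
      of the addition formula for \<open>T\<^sub>i\<^sub>+\<^sub>k(c)\<close>.\<close>
    define r where "r = u * t - v * (u\<^sup>2 - 1)"
    have u2: "u\<^sup>2 \<ge> 1" and v2: "v\<^sup>2 \<ge> v" and v2': "v\<^sup>2 \<ge> 1"
      using u v by (simp_all add: self_le_power)
    have "t\<^sup>2 < (u * v)\<^sup>2"
      using t(2) u2 v2' by (simp add: algebra_simps)
    moreover have "u * v \<ge> 0" using u v by simp
    ultimately have "t < u * v" by (rule power2_less_imp_less)
    then have "w \<ge> 1" by (simp add: w_def)
    have "((u - 1) * v)\<^sup>2 < t\<^sup>2"
    proof -
      have "t\<^sup>2 - ((u - 1) * v)\<^sup>2 = (u - 1) * (2 * v\<^sup>2 - u - 1)"
        unfolding t(2) by (simp add: power2_eq_square algebra_simps)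
      moreover have "\<dots> > 0" using u v v2 uv by (intro mult_pos_pos) auto
      ultimately show ?thesis by linarith
    qed
    then have "(u - 1) * v < t" using t(1) by (rule power2_less_imp_less)
    then have "w < v" by (simp add: w_def algebra_simps)
    have r: "(u\<^sup>2 - 1) * (w\<^sup>2 - 1) = r\<^sup>2"
    proof -
      have "r\<^sup>2 - (u\<^sup>2 - 1) * (w\<^sup>2 - 1) = t\<^sup>2 - (u\<^sup>2 - 1) * (v\<^sup>2 - 1)"
        by (simp add: r_def w_def power2_eq_square algebra_simps)
      then show ?thesis using t(2) by simp
    qed
    have "nat (u + w) < nat (a + b)" using uv(3) u \<open>w \<ge> 1\<close> \<open>w < v\<close> by linarith
    from less.hyps[OF this uv(1) \<open>w \<ge> 1\<close> r]
    obtain c i k where c: "c \<ge> 1" "u = cheb_T c i" "w = cheb_T c k" by blast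
    define e where "e = (c\<^sup>2 - 1) * (cheb_U c i * cheb_U c k)"
    have "u\<^sup>2 - 1 = (c\<^sup>2 - 1) * (cheb_U c i)\<^sup>2" "w\<^sup>2 - 1 = (c\<^sup>2 - 1) * (cheb_U c k)\<^sup>2"
      using cheb_pell[of c i] cheb_pell[of c k] c by simp_all
    then have "r\<^sup>2 = e\<^sup>2"
      unfolding r[symmetric] e_def by (simp only: power2_eq_square ac_simps)
    moreover have "e \<ge> 0"
      using c(1) cheb_nonneg(2)[OF c(1)] by (simp add: e_def)
    moreover have "r \<ge> 0"
    proof -
      have "(u * t)\<^sup>2 - (v * (u\<^sup>2 - 1))\<^sup>2 = (u\<^sup>2 - 1) * (v\<^sup>2 - u\<^sup>2)"
        unfolding power_mult_distrib t(2) by (simp add: power2_eq_square algebra_simps)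
      moreover have "\<dots> \<ge> 0" using u uv u2 by (intro mult_nonneg_nonneg) simp_all
      ultimately have "(v * (u\<^sup>2 - 1))\<^sup>2 \<le> (u * t)\<^sup>2" by linarith
      moreover have "u * t \<ge> 0" using u t(1) by simp
      ultimately have "v * (u\<^sup>2 - 1) \<le> u * t" by (rule power2_le_imp_le)
      then show ?thesis by (simp add: r_def)
    qed
    ultimately have "r = e" by (metis power2_eq_imp_eq)
    moreover have "v = u * w + r"
      by (simp add: w_def r_def power2_eq_square algebra_simps)
    ultimately have "v = cheb_T c (i + k)"
      using c by (simp add: e_def cheb_add)
    with c show ?thesis by blast
  qed
  show ?case
  proof (cases "a \<le> b")
    case True
    then show ?thesis using descent[of a b] less.prems by simp
  next
    case False
    then show ?thesis using descent[of b a] less.prems by (auto simp: mult.commute)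
  qed
qed

section \<open>Powers of 2 and 7 as Chebyshev values\<close>

text \<open>
  An even value has odd index and is therefore an odd multiple of \<open>c\<close>; the odd cofactor of \<open>c\<close> in
  a power of \<open>2\<close> can only be \<open>1\<close>.
\<close>

lemma cheb_T_eq_power_of_2:
  assumes "c \<ge> 1" "n > 0" "cheb_T c i = 2 ^ n"
  shows "c = 2 ^ n"
proof -
  have "odd i"
  proof
    assume "even i"
    then obtain k where "i = 2 * k" by (rule evenE)
    then have "odd ((2 :: int) ^ n)" using odd_cheb_T_even[of c k] assms(3) by simp
    then show False using assms(2) by simp
  qed
  then obtain k where "i = 2 * k + 1" by (rule oddE)
  then obtain q where q: "odd q" "2 ^ n = c * q" using cheb_T_odd_factor[of c k] assms by auto
  have "0 < c * q" unfolding q(2)[symmetric] by simp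
  then have "q > 0" using assms(1) by (simp add: zero_less_mult_iff)
  have "coprime q 2" using q(1) by (simp add: coprime_right_2_iff_odd)
  then have "coprime q (2 ^ n)" by simp
  moreover have "q dvd 2 ^ n" unfolding q(2) by simp
  ultimately have "is_unit q" by (metis coprime_absorb_left)
  with \<open>q > 0\<close> q(2) show ?thesis by simp
qed

text \<open>
  \<open>T\<^sub>4\<^sub>r = 2 * (2 * (T\<^sub>r)\<^sup>2 - 1)\<^sup>2 - 1\<close> vanishes modulo \<open>7\<close> only if \<open>2 * (T\<^sub>r)\<^sup>2 - 1\<close> is \<open>2\<close> or \<open>-2\<close>,
  that is, if \<open>(T\<^sub>r)\<^sup>2\<close> is one of the non-residues \<open>5\<close> and \<open>3\<close>.
\<close>

lemma seven_not_dvd_cheb_T_4: "\<not> 7 dvd cheb_T c (4 * r)"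
proof
  assume dvd: "7 dvd cheb_T c (4 * r)"
  define v where "v = cheb_T c r"
  have "(2 * v\<^sup>2 - 1) mod 7 \<in> {0, 1, 3, 6}"
  proof -
    have double: "(2 * y - 1) mod 7 \<in> {0, 1, 3, 6}" if "y mod 7 \<in> {0, 1, 2, 4}" for y :: int
      using that unfolding insert_iff empty_iff by presburger
    have "v mod 7 \<in> {0, 1, 2, 3, 4, 5, 6}" by auto
    then have "v\<^sup>2 mod 7 \<in> {0, 1, 2, 4}" unfolding power_mod[of v 7 2, symmetric] by auto
    then show ?thesis by (rule double)
  qed
  then have "(2 * v\<^sup>2 - 1)\<^sup>2 mod 7 \<in> {0, 1, 2}"
    unfolding power_mod[of "2 * v\<^sup>2 - 1" 7 2, symmetric] by auto
  moreover have "7 dvd 2 * (2 * v\<^sup>2 - 1)\<^sup>2 - 1"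
    using dvd cheb_T_double[of c "2 * r"] cheb_T_double[of c r] by (simp add: v_def)
  moreover have "\<not> 7 dvd 2 * y - 1" if "y mod 7 \<in> {0, 1, 2}" for y :: int
    using that unfolding insert_iff empty_iff by presburger
  ultimately show False by metis
qed

lemma not_16_dvd_7_power_plus_1: "\<not> (16 :: int) dvd 7 ^ n + 1"
proof -
  have "(7 :: int) ^ n mod 16 = 1 \<or> (7 :: int) ^ n mod 16 = 7"
  proof (induction n)
    case (Suc n)
    have "(7 :: int) ^ Suc n mod 16 = 7 * (7 ^ n mod 16) mod 16" by (simp add: mod_simps)
    with Suc show ?case by auto
  qed simp
  then show ?thesis by presburger
qed

text \<open>
  The index \<open>j\<close> is twice an odd number \<open>m\<close>, so that \<open>7 ^ n + 1 = 2 * (T\<^sub>m(2 ^ n))\<^sup>2\<close> is divisible by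
  \<open>2 * 4 ^ n\<close>, which is too much for \<open>n \<ge> 2\<close>.
\<close>

lemma cheb_T_power_2_eq_power_7:
  assumes "n > 0" "cheb_T (2 ^ n) j = 7 ^ n"
  shows "n = 1"
proof -
  let ?c = "2 ^ n :: int"
  have "even j"
  proof (rule ccontr)
    \<comment> \<open>An odd index would make the even number \<open>2 ^ n\<close> a divisor of \<open>7 ^ n\<close>.\<close>
    assume "odd j"
    then obtain k where "j = 2 * k + 1" by (rule oddE)
    then obtain q where "7 ^ n = ?c * q" using cheb_T_odd_factor[of ?c k] assms(2) by auto
    moreover have "even (?c * q)" using assms(1) by simp
    moreover have "odd ((7 :: int) ^ n)" by simp
    ultimately show False by metis
  qed
  then obtain m where m: "j = 2 * m" by (rule evenE)
  have "odd m"
  proof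
    assume "even m"
    then obtain r where "m = 2 * r" by (rule evenE)
    then have "cheb_T ?c (4 * r) = 7 ^ n" using assms(2) m by simp
    then show False using seven_not_dvd_cheb_T_4[of ?c r] assms(1) by simp
  qed
  then obtain k where "m = 2 * k + 1" by (rule oddE)
  then obtain q where "cheb_T ?c m = ?c * q" using cheb_T_odd_factor[of ?c k] by auto
  then have q: "7 ^ n + 1 = 2 * ?c\<^sup>2 * q\<^sup>2"
    using cheb_T_double[of ?c m] assms(2) m by (simp add: power_mult_distrib)
  show ?thesis
  proof (rule ccontr)
    assume "n \<noteq> 1"
    with assms(1) have "n \<ge> 2" by simp
    then obtain l where l: "n = Suc (Suc l)" by (metis add_2_eq_Suc le_Suc_ex)
    have "2 * ?c\<^sup>2 * q\<^sup>2 = 16 * (2 * (2 ^ l)\<^sup>2 * q\<^sup>2)" by (simp add: l power2_eq_square)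
    then show False unfolding q[symmetric] using not_16_dvd_7_power_plus_1[of n] by (metis dvd_triv_left)
  qed
qed

theorem corollary11:
  fixes n :: nat and x :: int
  assumes "n > 0" and "x > 0"
  shows "(4 ^ n - 1) * (49 ^ n - 1) = x ^ 2 \<longleftrightarrow> n = 1 \<and> x = 12"
proof
  assume eq: "(4 ^ n - 1) * (49 ^ n - 1) = x ^ 2"
  have "(4 :: int) ^ n = (2 ^ n)\<^sup>2" "(49 :: int) ^ n = (7 ^ n)\<^sup>2"
    by (simp_all add: power2_eq_square flip: power_mult_distrib)
  with eq have "((2 ^ n)\<^sup>2 - 1) * ((7 ^ n)\<^sup>2 - 1) = x\<^sup>2" by simp
  then obtain c i j where c: "c \<ge> 1" "2 ^ n = cheb_T c i" "7 ^ n = cheb_T c j"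
    using common_chebyshev_argument[of "2 ^ n" "7 ^ n" x] by auto
  then have "c = 2 ^ n" using cheb_T_eq_power_of_2 assms(1) by metis
  with c have "n = 1" using cheb_T_power_2_eq_power_7 assms(1) by metis
  then have "x\<^sup>2 = 12\<^sup>2" using eq by simp
  then have "x = 12" using assms(2) by (subst (asm) power2_eq_iff) simp
  with \<open>n = 1\<close> show "n = 1 \<and> x = 12" by simp
next
  assume "n = 1 \<and> x = 12"
  then show "(4 ^ n - 1) * (49 ^ n - 1) = x ^ 2" by simp
qed

end
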